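(* Let $\mathbb{A}$ be a nonnegative tensor with order $m\ge 2$ and dimension $n$. If the matrix $M(\mathbb{A})$ is irreducible, then the cyclic index of $M(\mathbb{A})$ is a multiple of the cyclic index of $\mathbb{A}$.
   Context: An order $m$ dimension $n$ tensor is an array $\mathbb{A}=(a_{i_1\cdots i_m})$ indexed by $[n]^m$, $[n]=\{1,\dots,n\}$; it is nonnegative if all entries are real and $\ge 0$. The majorization matrix $M(\mathbb{A})$ is the $n\times n$ matrix with $(M(\mathbb{A}))_{ij}=a_{ij\cdots j}$. A number $\lambda\in\mathbb{C}$ is an eigenvalue of $\mathbb{A}$ if there is a nonzero $x\in\mathbb{C}^n$ with $\sum_{i_2,\dots,i_m=1}^n a_{ii_2\cdots i_m}x_{i_2}\cdots x_{i_m}=\lambda x_i^{m-1}$ for all $i\in[n]$. The spectral radius $\rho(\mathbb{A})$ is the maximum modulus of the eigenvalues of $\mathbb{A}$. A tensor is irreducible if there is no nonempty proper subset $J\subset[n]$ with $a_{i_1i_2\cdots i_m}=0$ for all $i_1\in J$ and $i_2,\dots,i_m\notin J$ (for $m=2$ this is the usual irreducibility of matrices). The cyclic index of a nonnegative irreducible tensor $\mathbb{A}$ is the number of distinct eigenvalues of $\mathbb{A}$ whose absolute value is $\rho(\mathbb{A})$; for $m=2$ this is the cyclic index of a nonnegative irreducible matrix. It is known (Pearson) that if $M(\mathbb{A})$ is an irreducible matrix, then $\mathbb{A}$ is irreducible, so the cyclic index of $\mathbb{A}$ is defined. *)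

theory Defs
  imports "Jordan_Normal_Form.Spectral_Radius"
begin

text \<open>
  A real tensor of order \<open>m\<close> and dimension \<open>n\<close> is a function on index lists, of which only the
  values on \<open>tensor_indices m n\<close> matter.  Indices run over \<open>{0..<n}\<close> instead of
  \<open>{1..n}\<close>, in accordance with matrices and vectors of type \<open>mat\<close> and \<open>vec\<close>.
\<close>

type_synonym tensor = "nat list \<Rightarrow> real"

definition tensor_indices :: "nat \<Rightarrow> nat \<Rightarrow> nat list set" where
  "tensor_indices m n = {is. set is \<subseteq> {0..<n} \<and> length is = m}"

definition nonneg_tensor :: "nat \<Rightarrow> nat \<Rightarrow> tensor \<Rightarrow> bool" where
  "nonneg_tensor m n A \<longleftrightarrow> (\<forall>is \<in> tensor_indices m n. 0 \<le> A is)"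

definition majorization_mat :: "nat \<Rightarrow> nat \<Rightarrow> tensor \<Rightarrow> real mat" where
  "majorization_mat m n A = mat n n (\<lambda>(i, j). A (i # replicate (m - 1) j))"

definition tensor_eigenvalue :: "nat \<Rightarrow> nat \<Rightarrow> tensor \<Rightarrow> complex \<Rightarrow> bool" where
  "tensor_eigenvalue m n A k \<longleftrightarrow>
     (\<exists>x \<in> carrier_vec n. x \<noteq> 0\<^sub>v n \<and>
        (\<forall>i < n. (\<Sum>js \<in> tensor_indices (m - 1) n.
                    complex_of_real (A (i # js)) * (\<Prod>j\<leftarrow>js. x $ j))
                 = k * (x $ i) ^ (m - 1)))"

text \<open>
  The maximum is expressed by \<open>GREATEST\<close>, which, unlike \<open>Max\<close>, does not presuppose that the
  set of eigenvalues is known to be finite.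
\<close>

definition tensor_spectral_radius :: "nat \<Rightarrow> nat \<Rightarrow> tensor \<Rightarrow> real" where
  "tensor_spectral_radius m n A = (GREATEST r. \<exists>k. tensor_eigenvalue m n A k \<and> r = cmod k)"

definition tensor_cyclic_index :: "nat \<Rightarrow> nat \<Rightarrow> tensor \<Rightarrow> nat" where
  "tensor_cyclic_index m n A =
     card {k. tensor_eigenvalue m n A k \<and> cmod k = tensor_spectral_radius m n A}"

definition irreducible_tensor :: "nat \<Rightarrow> nat \<Rightarrow> tensor \<Rightarrow> bool" where
  "irreducible_tensor m n A \<longleftrightarrow>
     \<not> (\<exists>J. J \<noteq> {} \<and> J \<subset> {0..<n} \<and>
          (\<forall>i \<in> J. \<forall>js \<in> tensor_indices (m - 1) n. set js \<inter> J = {} \<longrightarrow> A (i # js) = 0))"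

definition irreducible_mat :: "real mat \<Rightarrow> bool" where
  "irreducible_mat B \<longleftrightarrow>
     \<not> (\<exists>J. J \<noteq> {} \<and> J \<subset> {0..<dim_row B} \<and>
          (\<forall>i \<in> J. \<forall>j \<in> {0..<dim_row B} - J. B $$ (i, j) = 0))"

definition mat_cyclic_index :: "real mat \<Rightarrow> nat" where
  "mat_cyclic_index B =
     card {k. eigenvalue (map_mat complex_of_real B) k \<and>
              cmod k = spectral_radius (map_mat complex_of_real B)}"

text \<open>The notions for square matrices are those for tensors of order 2.\<close>

definition tensor_of_mat :: "real mat \<Rightarrow> tensor" where
  "tensor_of_mat B = (\<lambda>is. B $$ (is ! 0, is ! 1))"

lemma tensor_indices_1: "tensor_indices (Suc 0) n = (\<lambda>j. [j]) ` {0..<n}"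
  by (auto simp: tensor_indices_def length_Suc_conv)

lemma irreducible_tensor_of_mat:
  assumes "B \<in> carrier_mat n n"
  shows "irreducible_tensor 2 n (tensor_of_mat B) \<longleftrightarrow> irreducible_mat B"
proof -
  have [simp]: "dim_row B = n" using assms by auto
  have "(\<forall>i \<in> J. \<forall>js \<in> tensor_indices (2 - 1) n. set js \<inter> J = {} \<longrightarrow> tensor_of_mat B (i # js) = 0)
     \<longleftrightarrow> (\<forall>i \<in> J. \<forall>j \<in> {0..<n} - J. B $$ (i, j) = 0)" for J
    by (auto simp: tensor_indices_1 tensor_of_mat_def)
  then show ?thesis
    unfolding irreducible_tensor_def irreducible_mat_def by simp
qed

lemma tensor_eigenvalue_of_mat:
  assumes B: "B \<in> carrier_mat n n"
  shows "tensor_eigenvalue 2 n (tensor_of_mat B) k \<longleftrightarrow> eigenvalue (map_mat complex_of_real B) k"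
proof -
  have d[simp]: "dim_row B = n" "dim_col B = n" using B by auto
  have "(\<forall>i < n. (\<Sum>js \<in> tensor_indices (2 - 1) n.
            complex_of_real (tensor_of_mat B (i # js)) * (\<Prod>j\<leftarrow>js. x $ j)) = k * (x $ i) ^ (2 - 1))
     \<longleftrightarrow> map_mat complex_of_real B *\<^sub>v x = k \<cdot>\<^sub>v x" if x: "x \<in> carrier_vec n" for x
  proof -
    have "(\<Sum>js \<in> tensor_indices (Suc 0) n.
            complex_of_real (tensor_of_mat B (i # js)) * (\<Prod>j\<leftarrow>js. x $ j))
          = (map_mat complex_of_real B *\<^sub>v x) $ i" if "i < n" for i
      using that x
      by (simp add: tensor_indices_1 sum.reindex inj_on_def tensor_of_mat_def scalar_prod_def)
    then show ?thesis using x by (auto simp: vec_eq_iff)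
  qed
  then show ?thesis
    unfolding tensor_eigenvalue_def eigenvalue_def eigenvector_def by auto
qed

lemma tensor_cyclic_index_of_mat:
  assumes B: "B \<in> carrier_mat n n" and n: "n \<ge> 1"
  shows "tensor_cyclic_index 2 n (tensor_of_mat B) = mat_cyclic_index B"
proof -
  let ?B = "map_mat complex_of_real B"
  have B': "?B \<in> carrier_mat n n" and n': "n \<noteq> 0" using B n by auto
  have "(GREATEST r. \<exists>k. eigenvalue ?B k \<and> r = cmod k) = spectral_radius ?B"
  proof (rule Greatest_equality)
    show "\<exists>k. eigenvalue ?B k \<and> spectral_radius ?B = cmod k"
      using spectral_radius_mem_max(1)[OF B'] n' by (auto simp: spectrum_def)
    show "r \<le> spectral_radius ?B" if "\<exists>k. eigenvalue ?B k \<and> r = cmod k" for r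
      using that spectral_radius_mem_max(2)[OF B'] n' by (auto simp: spectrum_def)
  qed
  then show ?thesis
    unfolding tensor_cyclic_index_def mat_cyclic_index_def tensor_spectral_radius_def
      tensor_eigenvalue_of_mat[OF B] by simp
qed

end

(*
  If p is a positive Perron vector of A with eigenvalue r, then an eigenvector x for an eigenvalue
  k with |k| = r satisfies |x| = t p.  Equality in the triangle inequality then forces the
  phases d_i = x_i / |x_i| to satisfy d_{i_2} ... d_{i_m} = (k / r) d_i^(m-1) on the support of A.
  So the numbers k / r form the multiplicative group G(A) of all unimodular mu for which such
  phases exist, and for r > 0 the cyclic index is the order of G(A).  Evaluating the phase equation
  at the indices i j ... j shows that the phases d_i^(m-1) witness mu in G(M(A)).  Hence G(A) is a
  subgroup of the finite group G(M(A)), and Lagrange's theorem applies.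
*)
theory Submission
  imports Defs "HOL-Analysis.Function_Topology" "HOL-Algebra.Coset"
begin

section \<open>Products over index lists\<close>

lemma prod_list_map_mult:
  "(\<Prod>j\<leftarrow>js. f j * g j) = (\<Prod>j\<leftarrow>js. f j) * (\<Prod>j\<leftarrow>js. g j :: 'a :: comm_monoid_mult)"
  by (induction js) (auto simp: algebra_simps)

lemma prod_list_map_cong:
  "(\<And>j. j \<in> set js \<Longrightarrow> f j = g j) \<Longrightarrow> (\<Prod>j\<leftarrow>js. f j) = (\<Prod>j\<leftarrow>js. g j :: 'a :: comm_monoid_mult)"
  by (induction js) auto

lemma prod_list_map_mono:
  fixes f g :: "'b \<Rightarrow> 'a :: linordered_idom"
  assumes "\<And>j. j \<in> set js \<Longrightarrow> 0 \<le> f j \<and> f j \<le> g j"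
  shows "(\<Prod>j\<leftarrow>js. f j) \<le> (\<Prod>j\<leftarrow>js. g j)"
  using assms
proof (induction js)
  case (Cons a js)
  have "0 \<le> (\<Prod>j\<leftarrow>js. f j)"
    by (rule prod_list_nonneg) (use Cons.prems in auto)
  with Cons show ?case
    by (auto intro!: mult_mono dest: order_trans)
qed auto

lemma norm_prod_list_map:
  "norm (\<Prod>j\<leftarrow>js. f j) = (\<Prod>j\<leftarrow>js. norm (f j :: 'a :: real_normed_field))"
  by (induction js) (auto simp: norm_mult)

lemma of_real_prod_list_map:
  "of_real (\<Prod>j\<leftarrow>js. f j) = (\<Prod>j\<leftarrow>js. of_real (f j) :: 'a :: real_normed_field)"
  by (induction js) auto

lemma prod_list_map_const: "(\<Prod>j\<leftarrow>js. c) = (c :: 'a :: comm_monoid_mult) ^ length js"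
  by (induction js) auto

lemma prod_list_map_pos:
  fixes f :: "'b \<Rightarrow> 'a :: linordered_idom"
  shows "(\<And>j. j \<in> set js \<Longrightarrow> 0 < f j) \<Longrightarrow> 0 < (\<Prod>j\<leftarrow>js. f j)"
  by (induction js) auto

lemma continuous_on_prod_list_map:
  fixes f :: "'b \<Rightarrow> 'c :: topological_space \<Rightarrow> real"
  assumes "\<And>j. continuous_on S (f j)"
  shows "continuous_on S (\<lambda>x. \<Prod>j\<leftarrow>js. f j x)"
  by (induction js) (auto intro!: continuous_intros assms)

section \<open>Index lists and the polynomial map of a tensor\<close>

lemma finite_tensor_indices [simp]: "finite (tensor_indices k n)"
  unfolding tensor_indices_def by (rule finite_lists_length_eq) simp

lemma length_tensor_indices: "js \<in> tensor_indices k n \<Longrightarrow> length js = k"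
  by (simp add: tensor_indices_def)

lemma set_tensor_indices: "js \<in> tensor_indices k n \<Longrightarrow> j \<in> set js \<Longrightarrow> j < n"
  by (auto simp: tensor_indices_def)

lemma replicate_tensor_indices: "j < n \<Longrightarrow> replicate k j \<in> tensor_indices k n"
  by (auto simp: tensor_indices_def)

text \<open>Vectors are functions into any real normed field, so that one map serves both the
  complex eigenvectors and the real positive vectors they are compared with.\<close>

definition tensor_apply :: "nat \<Rightarrow> nat \<Rightarrow> tensor \<Rightarrow> (nat \<Rightarrow> 'a :: real_normed_field) \<Rightarrow> nat \<Rightarrow> 'a" where
  "tensor_apply m n A x i =
     (\<Sum>js \<in> tensor_indices (m - 1) n. of_real (A (i # js)) * (\<Prod>j\<leftarrow>js. x j))"

text \<open>Index lists contain only indices below \<open>n\<close>, so values of \<open>x\<close>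
  elsewhere never enter and \<open>vec\<close> can be traded for plain functions.\<close>

lemma tensor_eigenvalue_iff:
  "tensor_eigenvalue m n A k \<longleftrightarrow>
     (\<exists>x. (\<exists>i<n. x i \<noteq> 0) \<and> (\<forall>i<n. tensor_apply m n A x i = k * x i ^ (m - 1)))"
proof
  assume "tensor_eigenvalue m n A k"
  then obtain x where "x \<in> carrier_vec n" "x \<noteq> 0\<^sub>v n"
    "\<forall>i<n. tensor_apply m n A (vec_index x) i = k * vec_index x i ^ (m - 1)"
    unfolding tensor_eigenvalue_def tensor_apply_def by auto
  moreover from this have "\<exists>i<n. vec_index x i \<noteq> 0"
    by (auto simp: vec_eq_iff)
  ultimately show "\<exists>x. (\<exists>i<n. x i \<noteq> 0) \<and> (\<forall>i<n. tensor_apply m n A x i = k * x i ^ (m - 1))"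
    by blast
next
  assume "\<exists>x. (\<exists>i<n. x i \<noteq> 0) \<and> (\<forall>i<n. tensor_apply m n A x i = k * x i ^ (m - 1))"
  then obtain x where x: "\<exists>i<n. x i \<noteq> 0" "\<forall>i<n. tensor_apply m n A x i = k * x i ^ (m - 1)"
    by blast
  let ?x = "Matrix.vec n x"
  have "(\<Prod>j\<leftarrow>js. vec_index ?x j) = (\<Prod>j\<leftarrow>js. x j)" if "js \<in> tensor_indices (m - 1) n" for js
    by (rule prod_list_map_cong) (use set_tensor_indices[OF that] in auto)
  then have "(\<Sum>js \<in> tensor_indices (m - 1) n.
               complex_of_real (A (i # js)) * (\<Prod>j\<leftarrow>js. vec_index ?x j)) = tensor_apply m n A x i" for i
    unfolding tensor_apply_def by (intro sum.cong) auto
  moreover have "?x \<noteq> 0\<^sub>v n"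
    using x(1) by (auto simp: vec_eq_iff)
  ultimately show "tensor_eigenvalue m n A k"
    unfolding tensor_eigenvalue_def using x(2) by (intro bexI[of _ ?x]) auto
qed

lemma tensor_apply_scale:
  "tensor_apply m n A (\<lambda>j. t * x j) i = t ^ (m - 1) * tensor_apply m n A x i"
  unfolding tensor_apply_def sum_distrib_left
  by (intro sum.cong refl) (auto simp: prod_list_map_mult prod_list_map_const length_tensor_indices algebra_simps)

lemma continuous_on_tensor_apply:
  assumes "\<And>j. continuous_on S (\<lambda>x. f x j)"
  shows "continuous_on S (\<lambda>x. tensor_apply m n A (f x) i :: real)"
  unfolding tensor_apply_def by (intro continuous_intros continuous_on_prod_list_map assms)

section \<open>The group of phases\<close>

text \<open>These are the unimodular \<mu> for which a unitary diagonal similarity takes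
  \<open>A\<close> to \<mu> times \<open>A\<close>. The condition sees only the support of
  \<open>A\<close>.\<close>

definition tensor_phases :: "nat \<Rightarrow> nat \<Rightarrow> tensor \<Rightarrow> complex set" where
  "tensor_phases m n A = {\<mu>. cmod \<mu> = 1 \<and> (\<exists>d. (\<forall>i<n. cmod (d i) = 1) \<and>
     (\<forall>i<n. \<forall>js \<in> tensor_indices (m - 1) n.
        A (i # js) \<noteq> 0 \<longrightarrow> (\<Prod>j\<leftarrow>js. d j) = \<mu> * d i ^ (m - 1)))}"

abbreviation unit_circle_group :: "complex monoid" where
  "unit_circle_group \<equiv> \<lparr>carrier = {z. cmod z = 1}, mult = (*), one = 1\<rparr>"

lemma group_unit_circle: "group unit_circle_group"
proof (rule groupI)
  fix x assume "x \<in> carrier unit_circle_group"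
  then show "\<exists>y \<in> carrier unit_circle_group. y \<otimes>\<^bsub>unit_circle_group\<^esub> x = \<one>\<^bsub>unit_circle_group\<^esub>"
    by (intro bexI[of _ "inverse x"]) (auto simp: norm_inverse intro!: left_inverse)
qed (auto simp: norm_mult)

lemma one_mem_tensor_phases: "1 \<in> tensor_phases m n A"
  unfolding tensor_phases_def by (auto intro!: exI[of _ "\<lambda>_. 1"] simp: prod_list_map_const)

lemma mult_mem_tensor_phases:
  assumes "\<mu> \<in> tensor_phases m n A" "\<nu> \<in> tensor_phases m n A"
  shows "\<mu> * \<nu> \<in> tensor_phases m n A"
proof -
  from assms obtain d e where
    "cmod \<mu> = 1" "\<forall>i<n. cmod (d i) = 1"
    "\<forall>i<n. \<forall>js \<in> tensor_indices (m - 1) n. A (i # js) \<noteq> 0 \<longrightarrow> (\<Prod>j\<leftarrow>js. d j) = \<mu> * d i ^ (m - 1)"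
    "cmod \<nu> = 1" "\<forall>i<n. cmod (e i) = 1"
    "\<forall>i<n. \<forall>js \<in> tensor_indices (m - 1) n. A (i # js) \<noteq> 0 \<longrightarrow> (\<Prod>j\<leftarrow>js. e j) = \<nu> * e i ^ (m - 1)"
    unfolding tensor_phases_def by blast
  then show ?thesis
    unfolding tensor_phases_def
    by (auto intro!: exI[of _ "\<lambda>i. d i * e i"] simp: prod_list_map_mult norm_mult power_mult_distrib)
qed

lemma tensor_phases_subset_circle: "tensor_phases m n A \<subseteq> {z. cmod z = 1}"
  unfolding tensor_phases_def by auto

lemma inverse_mem_tensor_phases:
  assumes "\<mu> \<in> tensor_phases m n A"
  shows "inverse \<mu> \<in> tensor_phases m n A"
proof -
  from assms obtain d where d:
    "cmod \<mu> = 1" "\<forall>i<n. cmod (d i) = 1"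
    "\<forall>i<n. \<forall>js \<in> tensor_indices (m - 1) n. A (i # js) \<noteq> 0 \<longrightarrow> (\<Prod>j\<leftarrow>js. d j) = \<mu> * d i ^ (m - 1)"
    unfolding tensor_phases_def by blast
  have "(\<Prod>j\<leftarrow>js. inverse (d j)) = inverse (\<Prod>j\<leftarrow>js. d j)" for js
    by (induction js) auto
  with d show ?thesis
    unfolding tensor_phases_def
    by (auto intro!: exI[of _ "\<lambda>i. inverse (d i)"] simp: norm_inverse power_inverse)
qed

lemma subgroup_tensor_phases: "subgroup (tensor_phases m n A) unit_circle_group"
proof (rule group.subgroupI[OF group_unit_circle])
  fix \<mu> assume \<mu>: "\<mu> \<in> tensor_phases m n A"
  then have "cmod \<mu> = 1" using tensor_phases_subset_circle by fastforce
  then have "inv\<^bsub>unit_circle_group\<^esub> \<mu> = inverse \<mu>"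
    by (intro group.inv_equality[OF group_unit_circle]) (auto simp: norm_inverse intro!: left_inverse)
  with inverse_mem_tensor_phases[OF \<mu>] show "inv\<^bsub>unit_circle_group\<^esub> \<mu> \<in> tensor_phases m n A"
    by simp
qed (use one_mem_tensor_phases[of m n A] mult_mem_tensor_phases[of _ m n A] tensor_phases_subset_circle[of m n A] in auto)

text \<open>Lagrange's theorem, applied inside the larger phase set as a finite group of its own,
  since the unit circle is infinite. The quotient counts the cosets.\<close>

lemma card_tensor_phases_dvd:
  assumes "tensor_phases m n A \<subseteq> tensor_phases m' n' B" and fin: "finite (tensor_phases m' n' B)"
  shows "card (tensor_phases m n A) dvd card (tensor_phases m' n' B)"
proof -
  let ?G = "unit_circle_group\<lparr>carrier := tensor_phases m' n' B\<rparr>"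
  interpret G: group ?G
    by (rule subgroup.subgroup_is_group[OF subgroup_tensor_phases group_unit_circle])
  have "subgroup (tensor_phases m n A) ?G"
    by (rule group.subgroup_incl[OF group_unit_circle subgroup_tensor_phases subgroup_tensor_phases assms(1)])
  from G.lagrange_finite[OF _ this] fin show ?thesis
    by (auto simp: order_def intro: dvdI[of _ _ "card (rcosets\<^bsub>?G\<^esub> tensor_phases m n A)"] simp: mult.commute)
qed

text \<open>The number \<mu> stays and only its witness changes: order 2 has exponent 1, so the
  power \<open>m - 1\<close> moves into the new phases.\<close>

lemma tensor_phases_subset_majorization:
  "tensor_phases m n A \<subseteq> tensor_phases 2 n (tensor_of_mat (majorization_mat m n A))"
proof
  fix \<mu> assume "\<mu> \<in> tensor_phases m n A"
  then obtain d where d: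
    "cmod \<mu> = 1" "\<forall>i<n. cmod (d i) = 1"
    "\<forall>i<n. \<forall>js \<in> tensor_indices (m - 1) n. A (i # js) \<noteq> 0 \<longrightarrow> (\<Prod>j\<leftarrow>js. d j) = \<mu> * d i ^ (m - 1)"
    unfolding tensor_phases_def by blast
  have "d j ^ (m - 1) = \<mu> * d i ^ (m - 1)" if "i < n" "j < n" "A (i # replicate (m - 1) j) \<noteq> 0" for i j
    using d(3) that replicate_tensor_indices[of j n "m - 1"] by (metis map_replicate prod_list_replicate)
  with d(1,2) show "\<mu> \<in> tensor_phases 2 n (tensor_of_mat (majorization_mat m n A))"
    unfolding tensor_phases_def
    by (auto intro!: exI[of _ "\<lambda>i. d i ^ (m - 1)"]
        simp: tensor_indices_1 tensor_of_mat_def majorization_mat_def norm_power)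
qed

section \<open>Irreducibility and monotonicity\<close>

text \<open>Abstract in order and tensor, in order to be instantiated with \<open>A\<close> and
  again with its majorization matrix as a tensor of order 2.\<close>

locale irreducible_majorization =
  fixes m n :: nat and A :: tensor
  assumes order: "m \<ge> 2" and dim: "n \<ge> 1"
    and nonneg: "nonneg_tensor m n A"
    and irred: "irreducible_mat (majorization_mat m n A)"
begin

lemma dim_pos: "0 < n"
  using dim by simp

lemma entry_nonneg: "i < n \<Longrightarrow> js \<in> tensor_indices (m - 1) n \<Longrightarrow> 0 \<le> A (i # js)"
  using nonneg order unfolding nonneg_tensor_def tensor_indices_def by auto

text \<open>Otherwise \<open>J\<close> would contradict irreducibility. The set \<open>J\<close> is
  mostly taken to be the coordinates where some inequality is tight; the edge leaving it then yields
  a strict inequality.\<close>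

lemma exists_edge:
  assumes "J \<noteq> {}" "\<And>i. i \<in> J \<Longrightarrow> i < n" "l < n" "l \<notin> J"
  obtains i j where "i \<in> J" "i < n" "j < n" "j \<notin> J" "A (i # replicate (m - 1) j) > 0"
proof -
  have "dim_row (majorization_mat m n A) = n" by (simp add: majorization_mat_def)
  moreover have "J \<subset> {0..<n}"
    using assms by (metis atLeastLessThan_iff le0 psubsetI subsetI)
  ultimately obtain i j where ij: "i \<in> J" "j \<in> {0..<n} - J" "majorization_mat m n A $$ (i, j) \<noteq> 0"
    using irred \<open>J \<noteq> {}\<close> unfolding irreducible_mat_def by metis
  then have "i < n" "j < n" using assms by auto
  with ij entry_nonneg[of i "replicate (m - 1) j"] that[of i j] show ?thesis
    by (auto simp: majorization_mat_def replicate_tensor_indices)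
qed

lemma tensor_apply_mono:
  fixes x y :: "nat \<Rightarrow> real"
  assumes "i < n" "\<And>j. j < n \<Longrightarrow> 0 \<le> x j" "\<And>j. j < n \<Longrightarrow> x j \<le> y j"
  shows "tensor_apply m n A x i \<le> tensor_apply m n A y i"
  unfolding tensor_apply_def using assms
  by (intro sum_mono mult_left_mono prod_list_map_mono) (auto simp: entry_nonneg set_tensor_indices)

text \<open>Strictness comes from the one monomial at \<open>i # replicate (m - 1) l\<close>, a pure
  power of coordinate \<open>l\<close> with positive exponent. A mixed monomial could stay zero
  through another vanishing coordinate.\<close>

lemma tensor_apply_strict_mono:
  fixes x y :: "nat \<Rightarrow> real"
  assumes i: "i < n" and x: "\<And>j. j < n \<Longrightarrow> 0 \<le> x j" and xy: "\<And>j. j < n \<Longrightarrow> x j \<le> y j"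
    and l: "l < n" "A (i # replicate (m - 1) l) > 0" "x l < y l"
  shows "tensor_apply m n A x i < tensor_apply m n A y i"
  unfolding tensor_apply_def
proof (rule sum_strict_mono_ex1)
  show "\<forall>js \<in> tensor_indices (m - 1) n. of_real (A (i # js)) * prod_list (map x js)
          \<le> of_real (A (i # js)) * prod_list (map y js)"
    using assms by (auto intro!: mult_left_mono prod_list_map_mono simp: entry_nonneg set_tensor_indices)
  have "x l ^ (m - 1) < y l ^ (m - 1)"
    using l x order by (intro power_strict_mono) auto
  with l show "\<exists>js \<in> tensor_indices (m - 1) n. of_real (A (i # js)) * prod_list (map x js)
          < of_real (A (i # js)) * prod_list (map y js)"
    by (intro bexI[of _ "replicate (m - 1) l"]) (auto simp: replicate_tensor_indices)
qed simp

lemma tensor_apply_nonneg: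
  fixes x :: "nat \<Rightarrow> real"
  assumes "i < n" "\<And>j. j < n \<Longrightarrow> 0 \<le> x j"
  shows "0 \<le> tensor_apply m n A x i"
  unfolding tensor_apply_def using assms
  by (intro sum_nonneg mult_nonneg_nonneg prod_list_nonneg) (auto simp: entry_nonneg set_tensor_indices)

section \<open>Existence of a positive eigenvector\<close>

text \<open>At a zero coordinate the bound vanishes because \<open>m - 1 > 0\<close>, whereas an
  edge from there to a positive coordinate makes the left side positive. So there are no zero
  coordinates.\<close>

lemma pos_of_subinvariant:
  fixes x :: "nat \<Rightarrow> real"
  assumes x: "\<And>j. j < n \<Longrightarrow> 0 \<le> x j" and nz: "\<exists>j<n. x j \<noteq> 0"
    and sub: "\<And>i. i < n \<Longrightarrow> tensor_apply m n A x i \<le> r * x i ^ (m - 1)"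
    and i: "i < n"
  shows "0 < x i"
proof (rule ccontr)
  assume "\<not> 0 < x i"
  with x i have "x i = 0" by force
  define J where "J = {i. i < n \<and> x i = 0}"
  obtain l where "l < n" "x l \<noteq> 0" using nz by blast
  obtain a b where ab: "a \<in> J" "a < n" "b < n" "b \<notin> J" "A (a # replicate (m - 1) b) > 0"
    by (rule exists_edge[of J l]) (use \<open>l < n\<close> \<open>x l \<noteq> 0\<close> \<open>x i = 0\<close> i in \<open>auto simp: J_def\<close>)
  have "0 < x b" using ab x[of b] by (auto simp: J_def)
  with ab have "tensor_apply m n A (\<lambda>_. 0) a < tensor_apply m n A x a"
    by (intro tensor_apply_strict_mono) (use x in auto)
  with sub[of a] ab order tensor_apply_nonneg[of a "\<lambda>_. 0"] show False
    by (auto simp: J_def power_0_left)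
qed

text \<open>
  The subinvariant vectors in the simplex form a compact set as long as zero coordinates are
  admitted; irreducibility excludes these afterwards.
\<close>

lemma exists_minimal_subinvariant:
  obtains r where
    "\<exists>x :: nat \<Rightarrow> real. (\<forall>i<n. 0 < x i) \<and> (\<forall>i<n. tensor_apply m n A x i \<le> r * x i ^ (m - 1))"
    "\<And>s (x :: nat \<Rightarrow> real). (\<forall>i<n. 0 < x i) \<Longrightarrow> (\<forall>i<n. tensor_apply m n A x i \<le> s * x i ^ (m - 1)) \<Longrightarrow> r \<le> s"
proof -
  \<comment> \<open>The all-one vector is subinvariant with factor \<open>C\<close>, so restricting
    the factors to \<open>{0..C}\<close> keeps the set below nonempty.\<close>
  define C where "C = (\<Sum>i<n. tensor_apply m n A (\<lambda>_. 1 :: real) i)"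
  have C: "tensor_apply m n A (\<lambda>_. 1) i \<le> C" if "i < n" for i
    unfolding C_def using that by (intro member_le_sum) (auto intro: tensor_apply_nonneg)
  have C0: "0 \<le> C" unfolding C_def by (auto intro!: sum_nonneg tensor_apply_nonneg)
  \<comment> \<open>Functions have infinitely many coordinates. Those from \<open>n\<close> on are
    pinned to 0, and the box is compact by Tychonoff's theorem.\<close>
  define B :: "nat \<Rightarrow> real set" where "B i = (if i < n then {0..1} else {0})" for i
  have "compactin (product_topology (\<lambda>_. euclidean) UNIV) (PiE UNIV B)"
    by (subst compactin_PiE) (auto simp: B_def)
  then have "compact (PiE UNIV B)"
    by (simp add: euclidean_product_topology)
  then have cK: "compact (PiE UNIV B \<times> {0..C})"
    by (intro compact_Times) auto
  \<comment> \<open>Vector and factor vary together, so that subinvariance is a closed condition and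
    the least factor is the minimum of the second projection on a compact set.\<close>
  define F where "F = {z :: (nat \<Rightarrow> real) \<times> real. (\<Sum>i<n. fst z i) = 1} \<inter>
    (\<Inter>i\<in>{..<n}. {z. tensor_apply m n A (fst z) i \<le> snd z * fst z i ^ (m - 1)})"
  have cont: "continuous_on UNIV (\<lambda>z :: (nat \<Rightarrow> real) \<times> real. fst z i)" for i
    by (rule continuous_on_compose2[OF continuous_on_product_coordinates continuous_on_fst[OF continuous_on_id]]) auto
  have "closed F" unfolding F_def
    by (intro closed_Int closed_INT ballI closed_Collect_le closed_Collect_eq
        continuous_on_tensor_apply continuous_intros cont)
  with cK have cK': "compact ((PiE UNIV B \<times> {0..C}) \<inter> F)"
    by (rule compact_Int_closed)
  \<comment> \<open>Both sides of the inequality are homogeneous of degree \<open>m - 1\<close>, so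
    \<open>x\<close> may be divided by its coordinate sum.\<close>
  have normalise: "\<exists>y. (y, s) \<in> (PiE UNIV B \<times> {0..C}) \<inter> F"
    if x: "\<forall>i<n. 0 < x i" and sub: "\<forall>i<n. tensor_apply m n A x i \<le> s * x i ^ (m - 1)" and sC: "s \<le> C"
    for x :: "nat \<Rightarrow> real" and s
  proof -
    define t where "t = (\<Sum>i<n. x i)"
    have t: "t > 0" unfolding t_def using x dim_pos by (intro sum_pos) (auto simp: lessThan_empty_iff)
    define y where "y i = (if i < n then (1 / t) * x i else 0)" for i
    have "tensor_apply m n A y i = tensor_apply m n A (\<lambda>j. (1 / t) * x j) i" for i
      unfolding tensor_apply_def
      by (intro sum.cong refl arg_cong2[where f = "(*)"] prod_list_map_cong)
         (auto simp: y_def set_tensor_indices)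
    then have ay: "tensor_apply m n A y i = (1 / t) ^ (m - 1) * tensor_apply m n A x i" for i
      by (simp only: tensor_apply_scale)
    have "tensor_apply m n A y i \<le> s * y i ^ (m - 1)" if "i < n" for i
    proof -
      have "tensor_apply m n A y i \<le> (1 / t) ^ (m - 1) * (s * x i ^ (m - 1))"
        unfolding ay using t sub that by (intro mult_left_mono) auto
      also have "\<dots> = s * y i ^ (m - 1)"
        using that by (simp only: y_def power_mult_distrib if_True) (simp add: algebra_simps)
      finally show ?thesis .
    qed
    moreover have "x i \<le> t" if "i < n" for i
      unfolding t_def using that x by (intro member_le_sum) (auto intro: less_imp_le)
    then have "y \<in> PiE UNIV B"
      using x t by (auto simp: B_def y_def less_imp_le)
    moreover have "(\<Sum>i<n. y i) = 1"
      using t by (simp add: y_def t_def flip: sum_divide_distrib)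
    moreover have "0 \<le> s"
    proof (rule ccontr)
      assume "\<not> 0 \<le> s"
      then have "s * x 0 ^ (m - 1) < 0" using x dim_pos by (auto intro!: mult_neg_pos)
      moreover have "0 \<le> tensor_apply m n A x 0"
        by (rule tensor_apply_nonneg) (use x dim_pos in \<open>auto simp: less_imp_le\<close>)
      ultimately show False using sub dim_pos by fastforce
    qed
    ultimately show ?thesis using sC by (auto simp: F_def)
  qed
  have "(PiE UNIV B \<times> {0..C}) \<inter> F \<noteq> {}"
  proof -
    have "\<exists>y. (y, C) \<in> (PiE UNIV B \<times> {0..C}) \<inter> F"
      using C by (intro normalise[of "\<lambda>_. 1"]) auto
    then show ?thesis by blast
  qed
  then obtain z where z: "z \<in> (PiE UNIV B \<times> {0..C}) \<inter> F"
    and zmin: "\<And>w. w \<in> (PiE UNIV B \<times> {0..C}) \<inter> F \<Longrightarrow> snd z \<le> snd w"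
    using continuous_attains_inf[OF cK' _ continuous_on_snd[OF continuous_on_id]] by blast
  show ?thesis
  proof (rule that[of "snd z"])
    have sub: "tensor_apply m n A (fst z) i \<le> snd z * fst z i ^ (m - 1)" if "i < n" for i
      using z that by (auto simp: F_def)
    have nn: "0 \<le> fst z i" if "i < n" for i
    proof -
      have "fst z i \<in> B i" using z by auto
      then show ?thesis using that by (simp add: B_def)
    qed
    have nz: "\<exists>i<n. fst z i \<noteq> 0"
      using z by (force simp: F_def intro: ccontr)
    have "0 < fst z i" if "i < n" for i
      by (rule pos_of_subinvariant[OF nn nz sub that])
    with sub show "\<exists>x. (\<forall>i<n. 0 < x i) \<and> (\<forall>i<n. tensor_apply m n A x i \<le> snd z * x i ^ (m - 1))"
      by blast
  next
    fix s and x :: "nat \<Rightarrow> real"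
    assume "\<forall>i<n. 0 < x i" "\<forall>i<n. tensor_apply m n A x i \<le> s * x i ^ (m - 1)"
    then show "snd z \<le> s"
      using normalise[of x s] zmin z by (cases "s \<le> C") fastforce+
  qed
qed

text \<open>
  Among the minimisers choose one with the fewest equality coordinates.  If some coordinate is not
  an equality coordinate, then shrinking all of those slightly destroys an equality along an edge
  leaving the equality set and creates none.
\<close>

lemma exists_perron_vector:
  obtains p :: "nat \<Rightarrow> real" and r :: real where "0 \<le> r" "\<And>i. i < n \<Longrightarrow> 0 < p i"
    "\<And>i. i < n \<Longrightarrow> tensor_apply m n A p i = r * p i ^ (m - 1)"
proof -
  obtain r where
    ex: "\<exists>x :: nat \<Rightarrow> real. (\<forall>i<n. 0 < x i) \<and> (\<forall>i<n. tensor_apply m n A x i \<le> r * x i ^ (m - 1))"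
    and least: "\<And>s (x :: nat \<Rightarrow> real). (\<forall>i<n. 0 < x i) \<Longrightarrow> (\<forall>i<n. tensor_apply m n A x i \<le> s * x i ^ (m - 1)) \<Longrightarrow> r \<le> s"
    by (rule exists_minimal_subinvariant) blast
  define good :: "(nat \<Rightarrow> real) \<Rightarrow> bool" where
    "good x \<longleftrightarrow> (\<forall>i<n. 0 < x i) \<and> (\<forall>i<n. tensor_apply m n A x i \<le> r * x i ^ (m - 1))" for x
  define S where "S x = {i. i < n \<and> tensor_apply m n A x i = r * x i ^ (m - 1)}" for x :: "nat \<Rightarrow> real"
  from ex have "\<exists>x. good x" by (simp add: good_def)
  then obtain x where x: "good x" and xmin: "\<And>y. good y \<Longrightarrow> card (S x) \<le> card (S y)"
    using ex_has_least_nat[of good _ "card \<circ> S"] by auto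
  have pos: "0 < x i" and sub: "tensor_apply m n A x i \<le> r * x i ^ (m - 1)" if "i < n" for i
    using x that by (auto simp: good_def)
  have slack: "tensor_apply m n A x i < r * x i ^ (m - 1)" if "i < n" "i \<notin> S x" for i
    using sub[OF that(1)] that by (auto simp: S_def)
  \<comment> \<open>With no equality coordinate, all of the finitely many inequalities have slack,
    and the same \<open>x\<close> would admit a factor slightly below \<open>r\<close>.\<close>
  have "S x \<noteq> {}"
  proof
    assume "S x = {}"
    have "\<forall>\<^sub>F s in at_left r. \<forall>i\<in>{..<n}. tensor_apply m n A x i < s * x i ^ (m - 1)"
    proof (rule eventually_ball_finite, simp, safe)
      fix i assume "i < n"
      have "((\<lambda>s. s * x i ^ (m - 1)) \<longlongrightarrow> r * x i ^ (m - 1)) (at_left r)"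
        by (intro tendsto_intros)
      then show "\<forall>\<^sub>F s in at_left r. tensor_apply m n A x i < s * x i ^ (m - 1)"
        by (rule order_tendstoD) (use slack \<open>S x = {}\<close> \<open>i < n\<close> in auto)
    qed
    moreover have "\<forall>\<^sub>F s in at_left r. s < r"
      by (simp add: eventually_at_filter)
    ultimately have "\<forall>\<^sub>F s in at_left r. s < r \<and> (\<forall>i\<in>{..<n}. tensor_apply m n A x i < s * x i ^ (m - 1))"
      by eventually_elim auto
    from eventually_happens'[OF trivial_limit_at_left_real this]
    obtain s where "s < r" "\<forall>i\<in>{..<n}. tensor_apply m n A x i < s * x i ^ (m - 1)"
      by blast
    with least[of x s] pos show False by (auto intro: less_imp_le)
  qed
  have all: "l \<in> S x" if "l < n" for l
  proof (rule ccontr)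
    assume "l \<notin> S x"
    obtain a b where ab: "a \<in> S x" "a < n" "b < n" "b \<notin> S x"
      "A (a # replicate (m - 1) b) > 0"
      by (rule exists_edge[OF \<open>S x \<noteq> {}\<close> _ \<open>l < n\<close> \<open>l \<notin> S x\<close>]) (auto simp: S_def)
    \<comment> \<open>Only the right side is scaled here. The left side can only drop when
      coordinates shrink (\<open>le\<close>), so its value at \<open>x\<close> suffices as a
      bound.\<close>
    have "\<forall>\<^sub>F s in at_left (1::real). \<forall>i\<in>{..<n} - S x. tensor_apply m n A x i < r * (s * x i) ^ (m - 1)"
    proof (rule eventually_ball_finite, simp, safe)
      fix i assume "i < n" "i \<notin> S x"
      have "((\<lambda>s. r * (s * x i) ^ (m - 1)) \<longlongrightarrow> r * (1 * x i) ^ (m - 1)) (at_left 1)"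
        by (intro tendsto_intros)
      then show "\<forall>\<^sub>F s in at_left 1. tensor_apply m n A x i < r * (s * x i) ^ (m - 1)"
        by (rule order_tendstoD) (use slack \<open>i < n\<close> \<open>i \<notin> S x\<close> in auto)
    qed
    moreover have "\<forall>\<^sub>F s in at_left (1::real). 0 < s \<and> s < 1"
      using eventually_at_left_real[of 0 "1::real"] by simp
    ultimately have "\<forall>\<^sub>F s in at_left 1. 0 < s \<and> s < 1 \<and>
        (\<forall>i\<in>{..<n} - S x. tensor_apply m n A x i < r * (s * x i) ^ (m - 1))"
      by eventually_elim auto
    from eventually_happens'[OF trivial_limit_at_left_real this]
    obtain s where s: "0 < s" "s < 1"
      "\<forall>i\<in>{..<n} - S x. tensor_apply m n A x i < r * (s * x i) ^ (m - 1)"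
      by blast
    define y where "y i = (if i \<in> S x then x i else s * x i)" for i
    have ypos: "0 < y i" and yx: "y i \<le> x i" if "i < n" for i
      using pos[OF that] s by (auto simp: y_def)
    have le: "tensor_apply m n A y i \<le> tensor_apply m n A x i" if "i < n" for i
      using that ypos yx by (intro tensor_apply_mono) (auto intro: less_imp_le)
    have out: "tensor_apply m n A y i < r * y i ^ (m - 1)" if "i < n" "i \<notin> S x" for i
      using le_less_trans[OF le[OF that(1)]] s(3) that by (simp add: y_def)
    have "good y"
      unfolding good_def using ypos le sub out
      by (metis (no_types, lifting) less_eq_real_def order_trans y_def)
    moreover have "tensor_apply m n A y a < tensor_apply m n A x a"
      by (rule tensor_apply_strict_mono[OF ab(2) less_imp_le[OF ypos] yx ab(3,5)])
         (use ab s pos[of b] in \<open>auto simp: y_def\<close>)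
    then have "a \<notin> S y" using ab sub[of a] by (auto simp: S_def y_def)
    with out ab(1) have "S y \<subset> S x" by (auto simp: S_def) (metis less_irrefl)+
    then have "card (S y) < card (S x)" by (intro psubset_card_mono) (auto simp: S_def)
    ultimately show False using xmin[of y] by simp
  qed
  then have eq: "tensor_apply m n A x i = r * x i ^ (m - 1)" if "i < n" for i
    using that by (auto simp: S_def)
  have "0 \<le> r"
  proof -
    have "0 \<le> r * x 0 ^ (m - 1)"
      using tensor_apply_nonneg[of 0 x] pos dim eq[of 0] by (auto intro: less_imp_le)
    moreover have "0 < x 0 ^ (m - 1)" using pos[of 0] dim_pos by simp
    ultimately show ?thesis by (simp add: zero_le_mult_iff)
  qed
  with pos eq that show ?thesis by blast
qed

lemma norm_tensor_apply_le:
  fixes x :: "nat \<Rightarrow> complex"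
  assumes "i < n"
  shows "cmod (tensor_apply m n A x i) \<le> tensor_apply m n A (\<lambda>j. cmod (x j)) i"
  unfolding tensor_apply_def
  by (rule sum_norm_le) (use assms in \<open>auto simp: norm_mult norm_prod_list_map entry_nonneg\<close>)

end

section \<open>Comparison of eigenvectors with the Perron vector\<close>

locale perron_vector = irreducible_majorization +
  fixes p :: "nat \<Rightarrow> real" and r :: real
  assumes r_nonneg: "0 \<le> r" and p_pos: "i < n \<Longrightarrow> 0 < p i"
    and p_eigen: "i < n \<Longrightarrow> tensor_apply m n A p i = r * p i ^ (m - 1)"
begin

text \<open>The largest ratio of \<open>cmod (x i)\<close> to \<open>p i\<close> serves as
  \<open>t\<close>: the multiple \<open>t * p\<close> dominates the moduli and touches them at
  \<open>i\<close>. The eigenvalue equation is then evaluated at such a touching coordinate.\<close>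

lemma eigenvector_abs_le:
  fixes x :: "nat \<Rightarrow> complex"
  assumes "\<exists>i<n. x i \<noteq> 0"
  obtains t i where "0 < t" "i < n" "cmod (x i) = t * p i" "\<And>j. j < n \<Longrightarrow> cmod (x j) \<le> t * p j"
proof -
  define f where "f i = cmod (x i) / p i" for i
  define t where "t = Max (f ` {..<n})"
  have "t \<in> f ` {..<n}" unfolding t_def using dim_pos by (intro Max_in) (auto simp: lessThan_empty_iff)
  then obtain i where i: "i < n" "t = f i" by auto
  have le: "f j \<le> t" if "j < n" for j unfolding t_def using that by (intro Max_ge) auto
  obtain l where l: "l < n" "x l \<noteq> 0" using assms by blast
  then have "0 < f l" using p_pos[of l] by (simp add: f_def)
  with le[of l] l have "0 < t" by simp
  moreover have "cmod (x j) \<le> t * p j" if "j < n" for j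
    using le[OF that] p_pos[OF that] by (simp add: f_def divide_le_eq)
  moreover have "cmod (x i) = t * p i"
    using i p_pos[of i] by (simp add: f_def)
  ultimately show ?thesis using that i by blast
qed

lemma scaled_eigen:
  "i < n \<Longrightarrow> tensor_apply m n A (\<lambda>j. t * p j) i = r * (t * p i) ^ (m - 1)"
  by (simp add: tensor_apply_scale p_eigen power_mult_distrib algebra_simps)

text \<open>At a touching coordinate, the triangle inequality and monotonicity bound
  \<open>cmod k\<close> times a positive power by \<open>r\<close> times the same power.\<close>

lemma eigenvalue_le:
  assumes "tensor_eigenvalue m n A k"
  shows "cmod k \<le> r"
proof -
  from assms obtain x where x: "\<exists>i<n. x i \<noteq> 0" "\<And>i. i < n \<Longrightarrow> tensor_apply m n A x i = k * x i ^ (m - 1)"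
    unfolding tensor_eigenvalue_iff by blast
  obtain t i where t: "0 < t" "i < n" "cmod (x i) = t * p i" "\<And>j. j < n \<Longrightarrow> cmod (x j) \<le> t * p j"
    using eigenvector_abs_le[OF x(1)] by blast
  have "cmod k * (t * p i) ^ (m - 1) = cmod (tensor_apply m n A x i)"
    using x(2)[OF t(2)] t(3) by (simp add: norm_mult norm_power)
  also have "\<dots> \<le> tensor_apply m n A (\<lambda>j. cmod (x j)) i"
    by (rule norm_tensor_apply_le) fact
  also have "\<dots> \<le> tensor_apply m n A (\<lambda>j. t * p j) i"
    by (rule tensor_apply_mono) (use t in auto)
  also have "\<dots> = r * (t * p i) ^ (m - 1)"
    by (rule scaled_eigen) fact
  finally show ?thesis
    using t p_pos[of i] by (simp add: mult_le_cancel_right)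
qed

text \<open>With \<open>cmod k = r\<close> the estimates of \<open>eigenvalue_le\<close> are tight
  at every touching coordinate. An edge from one of these to a coordinate that does not touch would
  make them strict.\<close>

lemma peripheral_eigenvector_abs:
  fixes x :: "nat \<Rightarrow> complex"
  assumes nz: "\<exists>i<n. x i \<noteq> 0"
    and x: "\<And>i. i < n \<Longrightarrow> tensor_apply m n A x i = k * x i ^ (m - 1)" and k: "cmod k = r"
  obtains t where "0 < t" "\<And>i. i < n \<Longrightarrow> cmod (x i) = t * p i"
proof -
  obtain t i where t: "0 < t" "i < n" "cmod (x i) = t * p i" "\<And>j. j < n \<Longrightarrow> cmod (x j) \<le> t * p j"
    using eigenvector_abs_le[OF nz] by blast
  define S where "S = {i. i < n \<and> cmod (x i) = t * p i}"
  have "l \<in> S" if "l < n" for l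
  proof (rule ccontr)
    assume "l \<notin> S"
    have "S \<noteq> {}" using t by (auto simp: S_def)
    obtain a b where ab: "a \<in> S" "a < n" "b < n" "b \<notin> S"
      "A (a # replicate (m - 1) b) > 0"
      by (rule exists_edge[OF \<open>S \<noteq> {}\<close> _ \<open>l < n\<close> \<open>l \<notin> S\<close>]) (auto simp: S_def)
    have "cmod (x b) < t * p b" using ab t(4)[of b] by (auto simp: S_def)
    with ab have "tensor_apply m n A (\<lambda>j. cmod (x j)) a < tensor_apply m n A (\<lambda>j. t * p j) a"
      by (intro tensor_apply_strict_mono) (use t in auto)
    also have "\<dots> = r * (t * p a) ^ (m - 1)"
      by (rule scaled_eigen) fact
    also have "\<dots> = cmod (tensor_apply m n A x a)"
      using x[OF ab(2)] ab(1) k by (simp add: norm_mult norm_power S_def)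
    also have "\<dots> \<le> tensor_apply m n A (\<lambda>j. cmod (x j)) a"
      by (rule norm_tensor_apply_le) fact
    finally show False by simp
  qed
  then have "cmod (x j) = t * p j" if "j < n" for j
    using that by (auto simp: S_def)
  with t(1) that show ?thesis by blast
qed

section \<open>Peripheral eigenvalues and phases\<close>

lemma phases_of_peripheral_eigenvalue:
  assumes ev: "tensor_eigenvalue m n A k" and k: "cmod k = r" and r: "0 < r"
  shows "k / of_real r \<in> tensor_phases m n A"
proof -
  from ev obtain x where nz: "\<exists>i<n. x i \<noteq> 0"
    and x: "\<And>i. i < n \<Longrightarrow> tensor_apply m n A x i = k * x i ^ (m - 1)"
    unfolding tensor_eigenvalue_iff by blast
  obtain t where t: "0 < t" and abs: "\<And>i. i < n \<Longrightarrow> cmod (x i) = t * p i"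
    using peripheral_eigenvector_abs[OF nz x k] by blast
  define d where "d i = sgn (x i)" for i
  have x_nz: "x i \<noteq> 0" if "i < n" for i
    using abs[OF that] t p_pos[OF that] by (metis less_irrefl mult_pos_pos norm_zero)
  then have d: "cmod (d i) = 1" if "i < n" for i
    using that by (simp add: d_def norm_sgn)
  have xd: "x i = of_real (t * p i) * d i" if "i < n" for i
    using x_nz[OF that] by (simp add: abs[OF that, symmetric] d_def sgn_eq)
  define \<mu> where "\<mu> = k / of_real r"
  have \<mu>: "cmod \<mu> = 1" using k r by (simp add: \<mu>_def norm_divide)
  have "(\<Prod>j\<leftarrow>js. d j) = \<mu> * d i ^ (m - 1)"
    if i: "i < n" and js: "js \<in> tensor_indices (m - 1) n" and nz: "A (i # js) \<noteq> 0" for i js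
  proof -
    \<comment> \<open>Dividing by the target value \<open>w\<close> turns the claim into
      \<open>q js = 1\<close>.\<close>
    define w where "w = \<mu> * d i ^ (m - 1)"
    have w: "cmod w = 1" using \<mu> d[OF i] by (simp add: w_def norm_mult norm_power)
    \<comment> \<open>The \<open>c js\<close> are the terms of the scaled Perron equation. The
      eigenvalue equation will say that multiplying them by the unimodular \<open>q js\<close>
      leaves their sum unchanged.\<close>
    define c where "c js = A (i # js) * (\<Prod>j\<leftarrow>js. t * p j)" for js
    have c_nonneg: "0 \<le> c js" if "js \<in> tensor_indices (m - 1) n" for js
      unfolding c_def using that i t p_pos set_tensor_indices[OF that]
      by (intro mult_nonneg_nonneg prod_list_nonneg) (auto simp: entry_nonneg less_imp_le)
    define q where "q js = (\<Prod>j\<leftarrow>js. d j) / w" for js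
    have q: "cmod (q js) = 1" if "js \<in> tensor_indices (m - 1) n" for js
    proof -
      have "(\<Prod>j\<leftarrow>js. cmod (d j)) = (\<Prod>j\<leftarrow>js. 1)"
        by (rule prod_list_map_cong) (use d set_tensor_indices[OF that] in auto)
      then show ?thesis using w by (simp add: q_def norm_divide norm_prod_list_map prod_list_map_const)
    qed
    have sum_c: "(\<Sum>js \<in> tensor_indices (m - 1) n. c js) = r * (t * p i) ^ (m - 1)"
      using scaled_eigen[OF i, of t] by (simp add: tensor_apply_def c_def)
    have "(\<Sum>js \<in> tensor_indices (m - 1) n. of_real (c js) * q js) * w = tensor_apply m n A x i"
      unfolding tensor_apply_def sum_distrib_right
    proof (rule sum.cong)
      fix js assume js: "js \<in> tensor_indices (m - 1) n"
      have "(\<Prod>j\<leftarrow>js. x j) = (\<Prod>j\<leftarrow>js. of_real (t * p j) * d j)"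
        by (rule prod_list_map_cong) (use xd set_tensor_indices[OF js] in auto)
      also have "\<dots> = of_real (\<Prod>j\<leftarrow>js. t * p j) * (\<Prod>j\<leftarrow>js. d j)"
        by (simp only: prod_list_map_mult[of _ d] of_real_prod_list_map)
      also have "(\<Prod>j\<leftarrow>js. d j) = q js * w"
        using w by (auto simp: q_def)
      finally show "of_real (c js) * q js * w = of_real (A (i # js)) * (\<Prod>j\<leftarrow>js. x j)"
        by (simp only: c_def of_real_mult mult.assoc)
    qed simp
    also have "\<dots> = of_real (r * (t * p i) ^ (m - 1)) * w"
      using r by (simp add: x[OF i] xd[OF i] w_def \<mu>_def power_mult_distrib)
    finally have "(\<Sum>js \<in> tensor_indices (m - 1) n. of_real (c js) * q js) = of_real (r * (t * p i) ^ (m - 1))"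
      using w by auto
    \<comment> \<open>Real parts reduce the equality case of the triangle inequality to a vanishing
      sum of nonnegative terms.\<close>
    from arg_cong[OF this, of Re]
    have "(\<Sum>js \<in> tensor_indices (m - 1) n. c js * Re (q js)) = r * (t * p i) ^ (m - 1)"
      by (simp only: Re_complex_of_real Re_sum) simp
    with sum_c have "(\<Sum>js \<in> tensor_indices (m - 1) n. c js * (1 - Re (q js))) = 0"
      by (simp add: right_diff_distrib sum_subtractf)
    moreover have "0 \<le> c js * (1 - Re (q js))" if "js \<in> tensor_indices (m - 1) n" for js
      using c_nonneg[OF that] q[OF that] complex_Re_le_cmod[of "q js"] by simp
    ultimately have "c js * (1 - Re (q js)) = 0"
      using js by (subst (asm) sum_nonneg_eq_0_iff) auto
    moreover have "c js \<noteq> 0"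
    proof -
      have "0 < (\<Prod>j\<leftarrow>js. t * p j)"
        by (rule prod_list_map_pos) (use t p_pos set_tensor_indices[OF js] in auto)
      with nz show ?thesis unfolding c_def by (metis less_irrefl mult_eq_0_iff)
    qed
    ultimately have "Re (q js) = 1" by simp
    moreover from this have "Im (q js) = 0"
      using q[OF js] by (simp add: cmod_def)
    ultimately have "q js = 1" by (simp add: complex_eq_iff)
    then show ?thesis using w by (auto simp: q_def w_def)
  qed
  with \<mu> d show ?thesis
    unfolding tensor_phases_def \<mu>_def[symmetric] by blast
qed

text \<open>An eigenvector has entries \<open>p i * d i\<close>: by the phase equation all nonzero
  terms share the factor \<open>\<mu> * d i ^ (m - 1)\<close>, which leaves the Perron
  equation.\<close>

lemma eigenvalue_of_phase:
  assumes "\<mu> \<in> tensor_phases m n A"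
  shows "tensor_eigenvalue m n A (of_real r * \<mu>)"
proof -
  from assms obtain d where d:
    "cmod \<mu> = 1" "\<forall>i<n. cmod (d i) = 1"
    "\<forall>i<n. \<forall>js \<in> tensor_indices (m - 1) n. A (i # js) \<noteq> 0 \<longrightarrow> (\<Prod>j\<leftarrow>js. d j) = \<mu> * d i ^ (m - 1)"
    unfolding tensor_phases_def by blast
  have "tensor_apply m n A (\<lambda>i. of_real (p i) * d i) i = of_real r * \<mu> * (of_real (p i) * d i) ^ (m - 1)"
    if i: "i < n" for i
  proof -
    have "tensor_apply m n A (\<lambda>i. of_real (p i) * d i) i
        = (\<Sum>js \<in> tensor_indices (m - 1) n. of_real (A (i # js) * (\<Prod>j\<leftarrow>js. p j)) * (\<mu> * d i ^ (m - 1)))"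
      unfolding tensor_apply_def
    proof (rule sum.cong)
      fix js assume "js \<in> tensor_indices (m - 1) n"
      with d(3) i have "A (i # js) = 0 \<or> (\<Prod>j\<leftarrow>js. d j) = \<mu> * d i ^ (m - 1)" by blast
      then show "of_real (A (i # js)) * (\<Prod>j\<leftarrow>js. of_real (p j) * d j)
          = of_real (A (i # js) * (\<Prod>j\<leftarrow>js. p j)) * (\<mu> * d i ^ (m - 1))"
        by (auto simp: prod_list_map_mult of_real_prod_list_map)
    qed simp
    also have "\<dots> = of_real (tensor_apply m n A p i) * (\<mu> * d i ^ (m - 1))"
      by (simp add: tensor_apply_def sum_distrib_right)
    finally show ?thesis
      by (simp add: p_eigen[OF i] power_mult_distrib)
  qed
  moreover have "of_real (p 0) * d 0 \<noteq> 0"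
    using p_pos[of 0] d(2) dim_pos by force
  ultimately show ?thesis
    unfolding tensor_eigenvalue_iff using dim_pos
    by (intro exI[of _ "\<lambda>i. of_real (p i) * d i"]) blast
qed

text \<open>The bound \<open>r\<close> is itself an eigenvalue, by the phase \<mu> = 1, so the
  greatest modulus exists.\<close>

lemma spectral_radius_eq: "tensor_spectral_radius m n A = r"
  unfolding tensor_spectral_radius_def
proof (rule Greatest_equality)
  show "\<exists>k. tensor_eigenvalue m n A k \<and> r = cmod k"
    using eigenvalue_of_phase[OF one_mem_tensor_phases] r_nonneg by (intro exI[of _ "of_real r"]) auto
qed (use eigenvalue_le in auto)

lemma peripheral_eigenvalues_eq:
  assumes "0 < r"
  shows "{k. tensor_eigenvalue m n A k \<and> cmod k = tensor_spectral_radius m n A}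
         = (\<lambda>\<mu>. of_real r * \<mu>) ` tensor_phases m n A"
proof (intro equalityI subsetI)
  fix k assume "k \<in> {k. tensor_eigenvalue m n A k \<and> cmod k = tensor_spectral_radius m n A}"
  then have "k / of_real r \<in> tensor_phases m n A"
    using phases_of_peripheral_eigenvalue assms by (simp add: spectral_radius_eq)
  then show "k \<in> (\<lambda>\<mu>. of_real r * \<mu>) ` tensor_phases m n A"
    by (rule rev_image_eqI) (use assms in simp)
next
  fix k assume "k \<in> (\<lambda>\<mu>. of_real r * \<mu>) ` tensor_phases m n A"
  then show "k \<in> {k. tensor_eigenvalue m n A k \<and> cmod k = tensor_spectral_radius m n A}"
    using assms tensor_phases_subset_circle[of m n A] eigenvalue_of_phase
    by (auto simp: spectral_radius_eq norm_mult)
qed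

lemma cyclic_index_eq_card_phases:
  assumes "0 < r"
  shows "tensor_cyclic_index m n A = card (tensor_phases m n A)"
  unfolding tensor_cyclic_index_def peripheral_eigenvalues_eq[OF assms]
  using assms by (intro card_image) (auto simp: inj_on_def)

text \<open>Here 0 is the only eigenvalue. The case does occur: the zero matrix of dimension 1
  counts as irreducible.\<close>

lemma cyclic_index_of_radius_0:
  assumes "r = 0"
  shows "tensor_cyclic_index m n A = 1"
proof -
  have "{k. tensor_eigenvalue m n A k \<and> cmod k = tensor_spectral_radius m n A} = {0}"
    using eigenvalue_of_phase[OF one_mem_tensor_phases] assms by (auto simp: spectral_radius_eq)
  then show ?thesis by (simp add: tensor_cyclic_index_def)
qed

text \<open>In dimension 1 no edge leads to another index, but the Perron equation has a single term
  and shows that the only entry is \<open>r\<close>.\<close>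

lemma diagonal_pos_of_dim_1:
  assumes "0 < r" "n = 1"
  shows "0 < A (replicate m 0)"
proof -
  have "tensor_indices (m - 1) 1 = {replicate (m - 1) 0}"
    by (auto simp: tensor_indices_def intro!: replicate_eqI)
  moreover have "Suc (m - 1) = m" using order by simp
  then have "0 # replicate (m - 1) 0 = replicate m (0::nat)" by (metis replicate_Suc)
  ultimately have "A (replicate m 0) * p 0 ^ (m - 1) = r * p 0 ^ (m - 1)"
    using p_eigen[of 0] \<open>n = 1\<close> by (simp add: tensor_apply_def)
  with p_pos[of 0] assms show ?thesis by simp
qed

end

section \<open>Divisibility of the cyclic indices\<close>

theorem theorem4p3:
  fixes A :: tensor and m n :: nat
  assumes "m \<ge> 2" and "n \<ge> 1"
    and "nonneg_tensor m n A"
    and "irreducible_mat (majorization_mat m n A)"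
  shows "tensor_cyclic_index m n A dvd mat_cyclic_index (majorization_mat m n A)"
proof -
  define M where "M = majorization_mat m n A"
  have M: "M \<in> carrier_mat n n" by (simp add: M_def majorization_mat_def)
  interpret A: irreducible_majorization m n A
    by unfold_locales (use assms in auto)
  \<comment> \<open>A matrix viewed as a tensor of order 2 is its own majorization matrix, so
    irreducibility of \<open>M\<close> lets the locale apply to it too.\<close>
  have "majorization_mat 2 n (tensor_of_mat M) = M"
    using M by (auto simp: majorization_mat_def tensor_of_mat_def)
  moreover have "nonneg_tensor 2 n (tensor_of_mat M)"
    unfolding nonneg_tensor_def
  proof
    fix js assume "js \<in> tensor_indices 2 n"
    then obtain i j where "js = [i, j]" "i < n" "j < n"
      by (auto simp: tensor_indices_def length_Suc_conv numeral_2_eq_2)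
    then show "0 \<le> tensor_of_mat M js"
      by (simp add: tensor_of_mat_def M_def majorization_mat_def A.entry_nonneg replicate_tensor_indices)
  qed
  ultimately interpret M: irreducible_majorization 2 n "tensor_of_mat M"
    using assms by unfold_locales (auto simp: M_def)
  obtain p r where "perron_vector m n A p r"
    using A.exists_perron_vector
    by (metis A.irreducible_majorization_axioms perron_vector.intro perron_vector_axioms.intro)
  then interpret A: perron_vector m n A p r .
  obtain q s where "perron_vector 2 n (tensor_of_mat M) q s"
    using M.exists_perron_vector
    by (metis M.irreducible_majorization_axioms perron_vector.intro perron_vector_axioms.intro)
  then interpret M: perron_vector 2 n "tensor_of_mat M" q s .
  show ?thesis
  proof (cases "r = 0")
    case True
    then show ?thesis by (simp add: A.cyclic_index_of_radius_0)
  next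
    case False
    then have r: "0 < r" using A.r_nonneg by simp
    \<comment> \<open>A positive entry in row 0 of \<open>M\<close> will force \<open>s > 0\<close>,
      by comparing \<open>q\<close> with the zero vector.\<close>
    have "\<exists>j<n. A (0 # replicate (m - 1) j) > 0"
    proof (cases "n = 1")
      case True
      then show ?thesis
        using A.diagonal_pos_of_dim_1[OF r True] assms(1)
        by (intro exI[of _ 0]) (simp flip: replicate_Suc)
    next
      case False
      with assms(2) have "0 < n" "1 < n" by auto
      show ?thesis
        by (rule A.exists_edge[of "{0}" 1]) (use \<open>0 < n\<close> \<open>1 < n\<close> in auto)
    qed
    then obtain j where j: "j < n" "A (0 # replicate (m - 1) j) > 0" by blast
    have "tensor_apply 2 n (tensor_of_mat M) (\<lambda>_. 0) 0 < tensor_apply 2 n (tensor_of_mat M) q 0"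
      using j M.p_pos assms(2)
      by (intro M.tensor_apply_strict_mono[of 0 _ _ j])
         (auto simp: tensor_of_mat_def M_def majorization_mat_def less_imp_le)
    then have "0 < s * q 0"
      using M.p_eigen[of 0] M.tensor_apply_nonneg[of 0 "\<lambda>_. 0"] assms(2) by simp
    then have s: "0 < s" using M.p_pos[of 0] assms(2) by (simp add: zero_less_mult_iff)
    \<comment> \<open>Finiteness comes from the matrix side: multiplication by \<open>s\<close>
      embeds the phases of \<open>M\<close> into its finite spectrum.\<close>
    have "finite {k. tensor_eigenvalue 2 n (tensor_of_mat M) k}"
      using card_finite_spectrum(1)[of "map_mat complex_of_real M" n] M
      by (simp add: spectrum_def tensor_eigenvalue_of_mat[OF M])
    then have "finite ((\<lambda>\<mu>. of_real s * \<mu>) ` tensor_phases 2 n (tensor_of_mat M))"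
      unfolding M.peripheral_eigenvalues_eq[OF s, symmetric] by (rule rev_finite_subset) auto
    then have "finite (tensor_phases 2 n (tensor_of_mat M))"
      by (rule finite_imageD) (use s in \<open>auto simp: inj_on_def\<close>)
    with tensor_phases_subset_majorization[of m n A]
    have "card (tensor_phases m n A) dvd card (tensor_phases 2 n (tensor_of_mat M))"
      unfolding M_def by (intro card_tensor_phases_dvd)
    then show ?thesis
      using A.cyclic_index_eq_card_phases[OF r] M.cyclic_index_eq_card_phases[OF s]
        tensor_cyclic_index_of_mat[OF M assms(2)] by (simp add: M_def)
  qed
qed

end
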